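(* Let $G$ and $H$ be two left-orderable groups. Then the free product $G*H$ has no isolated left-orderings.
   Context: A left-ordering on a group $\Gamma$ is a total order $\preceq$ on $\Gamma$ such that $\gamma_1\prec\gamma_2$ implies $\gamma_3\gamma_1\prec\gamma_3\gamma_2$ for all $\gamma_1,\gamma_2,\gamma_3\in\Gamma$. A group is left-orderable if it admits a left-ordering. A left-ordering $\preceq$ of $\Gamma$ is called isolated if there is a finite family $\{\gamma_1,\ldots,\gamma_n\}\subset\Gamma$ such that $\preceq$ is the only left-ordering of $\Gamma$ with the property that $\gamma_i\succ id$ for $1\le i\le n$. Equivalently, $\preceq$ is an isolated point of the space $\mathcal{LO}(\Gamma)$ of all left-orderings of $\Gamma$, topologized as a subspace of $\{0,1\}^\Gamma$ (product topology) by identifying $\preceq$ with the characteristic function of its positive cone $\{\gamma\in\Gamma : \gamma\succ id\}$.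
   Formalization: Both groups G and H are assumed nontrivial; with a trivial factor the claim fails, e.g. G trivial and H = Z gives G*H = Z, whose two left-orderings are isolated. *)

theory Defs
  imports "HOL-Algebra.Elementary_Groups"
begin

section \<open>Left-orderings\<close>

definition left_ordering :: "('a, 'b) monoid_scheme \<Rightarrow> 'a rel \<Rightarrow> bool" where
  "left_ordering G r \<longleftrightarrow>
     linear_order_on (carrier G) r \<and>
     (\<forall>x\<in>carrier G. \<forall>y\<in>carrier G. \<forall>z\<in>carrier G.
        (x, y) \<in> r - Id \<longrightarrow> (z \<otimes>\<^bsub>G\<^esub> x, z \<otimes>\<^bsub>G\<^esub> y) \<in> r - Id)"

definition left_orderable :: "('a, 'b) monoid_scheme \<Rightarrow> bool" where
  "left_orderable G \<longleftrightarrow> (\<exists>r. left_ordering G r)"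

text \<open>By \<^const>\<open>linear_order_on\<close> an ordering is a subset of
  \<^term>\<open>carrier G \<times> carrier G\<close>, so equality of relations below is equality of orderings.\<close>

definition isolated_left_ordering :: "('a, 'b) monoid_scheme \<Rightarrow> 'a rel \<Rightarrow> bool" where
  "isolated_left_ordering G r \<longleftrightarrow>
     left_ordering G r \<and>
     (\<exists>S. finite S \<and> S \<subseteq> carrier G \<and>
        (\<forall>x\<in>S. (\<one>\<^bsub>G\<^esub>, x) \<in> r - Id) \<and>
        (\<forall>s. left_ordering G s \<and> (\<forall>x\<in>S. (\<one>\<^bsub>G\<^esub>, x) \<in> s - Id) \<longrightarrow> s = r))"

section \<open>Free products\<close>

text \<open>The elements of the free product are the reduced words: lists of nontrivial elements
  of the two groups, in which neighbouring letters come from different groups.\<close>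

definition reduced_word ::
  "('a, 'c) monoid_scheme \<Rightarrow> ('b, 'd) monoid_scheme \<Rightarrow> ('a + 'b) list \<Rightarrow> bool" where
  "reduced_word G H w \<longleftrightarrow>
     set w \<subseteq> (carrier G - {\<one>\<^bsub>G\<^esub>}) <+> (carrier H - {\<one>\<^bsub>H\<^esub>}) \<and>
     successively (\<lambda>x y. isl x \<noteq> isl y) w"

text \<open>Product of a single (nontrivial) letter with a reduced word.\<close>

fun letter_mult ::
  "('a, 'c) monoid_scheme \<Rightarrow> ('b, 'd) monoid_scheme \<Rightarrow> 'a + 'b \<Rightarrow> ('a + 'b) list \<Rightarrow> ('a + 'b) list"
where
  "letter_mult G H (Inl g) (Inl g' # w) =
     (if g \<otimes>\<^bsub>G\<^esub> g' = \<one>\<^bsub>G\<^esub> then w else Inl (g \<otimes>\<^bsub>G\<^esub> g') # w)"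
| "letter_mult G H (Inr h) (Inr h' # w) =
     (if h \<otimes>\<^bsub>H\<^esub> h' = \<one>\<^bsub>H\<^esub> then w else Inr (h \<otimes>\<^bsub>H\<^esub> h') # w)"
| "letter_mult G H x w = x # w"

definition free_product ::
  "('a, 'c) monoid_scheme \<Rightarrow> ('b, 'd) monoid_scheme \<Rightarrow> ('a + 'b) list monoid" where
  "free_product G H =
     \<lparr>carrier = {w. reduced_word G H w},
      monoid.mult = (\<lambda>u v. foldr (letter_mult G H) u v),
      one = []\<rparr>"

definition free_product_inl ::
  "('a, 'c) monoid_scheme \<Rightarrow> 'a \<Rightarrow> ('a + 'b) list" where
  "free_product_inl G g = (if g = \<one>\<^bsub>G\<^esub> then [] else [Inl g])"

definition free_product_inr ::
  "('b, 'd) monoid_scheme \<Rightarrow> 'b \<Rightarrow> ('a + 'b) list" where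
  "free_product_inr H h = (if h = \<one>\<^bsub>H\<^esub> then [] else [Inr h])"

context
  fixes G :: "('a, 'c) monoid_scheme" and H :: "('b, 'd) monoid_scheme"
  assumes G: "group G" and H: "group H"
begin

interpretation G: group G by (fact G)
interpretation H: group H by (fact H)

abbreviation (input) "letters \<equiv> (carrier G - {\<one>\<^bsub>G\<^esub>}) <+> (carrier H - {\<one>\<^bsub>H\<^esub>})"

lemma reduced_Nil: "reduced_word G H []"
  by (simp add: reduced_word_def)

lemma reduced_Cons:
  "reduced_word G H (x # w) \<longleftrightarrow>
     x \<in> letters \<and> reduced_word G H w \<and> (w \<noteq> [] \<longrightarrow> isl x \<noteq> isl (hd w))"
  by (auto simp: reduced_word_def successively_Cons)

lemma reduced_letter_mult:
  "x \<in> letters \<Longrightarrow> reduced_word G H w \<Longrightarrow> reduced_word G H (letter_mult G H x w)"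
  by (cases x; cases w; cases "hd w") (auto simp: reduced_Cons)

lemma letter_mult_Inl_Inl:
  assumes "Inl g \<in> letters" "Inl g' \<in> letters" "reduced_word G H w"
  shows "letter_mult G H (Inl g) (letter_mult G H (Inl g') w) =
    (if g \<otimes>\<^bsub>G\<^esub> g' = \<one>\<^bsub>G\<^esub> then w else letter_mult G H (Inl (g \<otimes>\<^bsub>G\<^esub> g')) w)"
proof (cases w)
  case Nil
  then show ?thesis by simp
next
  case (Cons y v)
  show ?thesis
  proof (cases y)
    case (Inr h)
    then show ?thesis using Cons by simp
  next
    case (Inl k)
    have mem: "g \<in> carrier G" "g' \<in> carrier G" "k \<in> carrier G" "k \<noteq> \<one>\<^bsub>G\<^esub>" "g \<noteq> \<one>\<^bsub>G\<^esub>"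
      using assms Cons Inl by (auto simp: reduced_Cons)
    have v: "letter_mult G H (Inl g) v = Inl g # v"
      using assms(3) Cons Inl by (cases v; cases "hd v") (auto simp: reduced_Cons)
    have a: "g \<otimes>\<^bsub>G\<^esub> g' \<otimes>\<^bsub>G\<^esub> k = g \<otimes>\<^bsub>G\<^esub> (g' \<otimes>\<^bsub>G\<^esub> k)"
      using mem G.m_assoc by blast
    have c: "g \<otimes>\<^bsub>G\<^esub> g' = \<one>\<^bsub>G\<^esub> \<Longrightarrow> g \<otimes>\<^bsub>G\<^esub> (g' \<otimes>\<^bsub>G\<^esub> k) = k"
      using mem a by simp
    show ?thesis
      using Cons Inl mem v a c by auto
  qed
qed

lemma letter_mult_Inr_Inr:
  assumes "Inr g \<in> letters" "Inr g' \<in> letters" "reduced_word G H w"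
  shows "letter_mult G H (Inr g) (letter_mult G H (Inr g') w) =
    (if g \<otimes>\<^bsub>H\<^esub> g' = \<one>\<^bsub>H\<^esub> then w else letter_mult G H (Inr (g \<otimes>\<^bsub>H\<^esub> g')) w)"
proof (cases w)
  case Nil
  then show ?thesis by simp
next
  case (Cons y v)
  show ?thesis
  proof (cases y)
    case (Inl h)
    then show ?thesis using Cons by simp
  next
    case (Inr k)
    have mem: "g \<in> carrier H" "g' \<in> carrier H" "k \<in> carrier H" "k \<noteq> \<one>\<^bsub>H\<^esub>" "g \<noteq> \<one>\<^bsub>H\<^esub>"
      using assms Cons Inr by (auto simp: reduced_Cons)
    have v: "letter_mult G H (Inr g) v = Inr g # v"
      using assms(3) Cons Inr by (cases v; cases "hd v") (auto simp: reduced_Cons)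
    have a: "g \<otimes>\<^bsub>H\<^esub> g' \<otimes>\<^bsub>H\<^esub> k = g \<otimes>\<^bsub>H\<^esub> (g' \<otimes>\<^bsub>H\<^esub> k)"
      using mem H.m_assoc by blast
    have c: "g \<otimes>\<^bsub>H\<^esub> g' = \<one>\<^bsub>H\<^esub> \<Longrightarrow> g \<otimes>\<^bsub>H\<^esub> (g' \<otimes>\<^bsub>H\<^esub> k) = k"
      using mem a by simp
    show ?thesis
      using Cons Inr mem v a c by auto
  qed
qed

lemma reduced_foldr:
  "set u \<subseteq> letters \<Longrightarrow> reduced_word G H w \<Longrightarrow> reduced_word G H (foldr (letter_mult G H) u w)"
  by (induction u) (simp_all add: reduced_letter_mult)

lemma foldr_letter_mult:
  assumes "x \<in> letters" "reduced_word G H u" "reduced_word G H w"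
  shows "foldr (letter_mult G H) (letter_mult G H x u) w =
         letter_mult G H x (foldr (letter_mult G H) u w)"
proof (cases u)
  case Nil
  then show ?thesis by (cases x) auto
next
  case (Cons y v)
  have y: "y \<in> letters" and v: "set v \<subseteq> letters"
    using assms(2) Cons by (auto simp: reduced_word_def)
  have r: "reduced_word G H (foldr (letter_mult G H) v w)"
    using v assms(3) by (rule reduced_foldr)
  show ?thesis
  proof (cases x; cases y)
    fix a b assume "x = Inl a" "y = Inl b"
    then show ?thesis
      using letter_mult_Inl_Inl[of a b, OF _ _ r] assms(1) y Cons by auto
  next
    fix a b assume "x = Inr a" "y = Inr b"
    then show ?thesis
      using letter_mult_Inr_Inr[of a b, OF _ _ r] assms(1) y Cons by auto
  qed (use Cons in auto)
qed

lemma foldr_assoc: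
  assumes "set u \<subseteq> letters" "reduced_word G H v" "reduced_word G H w"
  shows "foldr (letter_mult G H) (foldr (letter_mult G H) u v) w =
         foldr (letter_mult G H) u (foldr (letter_mult G H) v w)"
  using assms(1)
  by (induction u) (use assms in \<open>simp_all add: foldr_letter_mult reduced_foldr\<close>)

lemma foldr_reduced_Nil: "reduced_word G H w \<Longrightarrow> foldr (letter_mult G H) w [] = w"
proof (induction w)
  case (Cons x w)
  then show ?case
    by (cases x; cases w; cases "hd w") (auto simp: reduced_Cons)
qed simp

lemma letter_inverse:
  assumes "x \<in> letters"
  obtains y where "y \<in> letters" "\<And>w. reduced_word G H w \<Longrightarrow> letter_mult G H y (letter_mult G H x w) = w"
proof (cases x)
  case (Inl g)
  have "Inl (inv\<^bsub>G\<^esub> g) \<in> letters" using assms Inl by auto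
  then show ?thesis
    using assms Inl by (intro that[of "Inl (inv\<^bsub>G\<^esub> g)"]) (auto simp: letter_mult_Inl_Inl)
next
  case (Inr h)
  have "Inr (inv\<^bsub>H\<^esub> h) \<in> letters" using assms Inr by auto
  then show ?thesis
    using assms Inr by (intro that[of "Inr (inv\<^bsub>H\<^esub> h)"]) (auto simp: letter_mult_Inr_Inr)
qed

lemma foldr_inverse:
  assumes "set u \<subseteq> letters"
  shows "\<exists>v. reduced_word G H v \<and>
    (\<forall>w. reduced_word G H w \<longrightarrow> foldr (letter_mult G H) v (foldr (letter_mult G H) u w) = w)"
  using assms
proof (induction u)
  case Nil
  then show ?case by (intro exI[of _ "[]"]) (simp add: reduced_Nil)
next
  case (Cons x u)
  then obtain v where v: "reduced_word G H v"
    "\<And>w. reduced_word G H w \<Longrightarrow> foldr (letter_mult G H) v (foldr (letter_mult G H) u w) = w"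
    by auto
  obtain y where y: "y \<in> letters"
    "\<And>w. reduced_word G H w \<Longrightarrow> letter_mult G H y (letter_mult G H x w) = w"
    using Cons.prems letter_inverse[of x] by auto
  have yr: "reduced_word G H [y]" using y(1) by (simp add: reduced_Cons reduced_Nil)
  have vs: "set v \<subseteq> letters" using v(1) by (simp add: reduced_word_def)
  show ?case
  proof (intro exI[of _ "foldr (letter_mult G H) v [y]"] conjI allI impI)
    show "reduced_word G H (foldr (letter_mult G H) v [y])"
      using vs yr by (rule reduced_foldr)
    fix w assume w: "reduced_word G H w"
    have r: "reduced_word G H (foldr (letter_mult G H) u w)"
      using Cons.prems w by (auto intro: reduced_foldr)
    have r': "reduced_word G H (letter_mult G H x (foldr (letter_mult G H) u w))"
      using Cons.prems r by (auto intro: reduced_letter_mult)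
    show "foldr (letter_mult G H) (foldr (letter_mult G H) v [y])
            (foldr (letter_mult G H) (x # u) w) = w"
      using foldr_assoc[OF vs yr r'] y(2)[OF r] v(2)[OF w] by simp
  qed
qed

lemma group_free_product: "group (free_product G H)"
proof (rule groupI)
  fix x y assume "x \<in> carrier (free_product G H)" "y \<in> carrier (free_product G H)"
  then show "x \<otimes>\<^bsub>free_product G H\<^esub> y \<in> carrier (free_product G H)"
    by (auto simp: free_product_def reduced_word_def[of G H x] intro!: reduced_foldr)
next
  fix x y z assume "x \<in> carrier (free_product G H)" "y \<in> carrier (free_product G H)"
    "z \<in> carrier (free_product G H)"
  then show "x \<otimes>\<^bsub>free_product G H\<^esub> y \<otimes>\<^bsub>free_product G H\<^esub> z =
      x \<otimes>\<^bsub>free_product G H\<^esub> (y \<otimes>\<^bsub>free_product G H\<^esub> z)"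
    by (auto simp: free_product_def reduced_word_def[of G H x] intro!: foldr_assoc)
next
  fix x assume "x \<in> carrier (free_product G H)"
  then obtain v where "reduced_word G H v"
    "foldr (letter_mult G H) v (foldr (letter_mult G H) x []) = []" "reduced_word G H x"
    using foldr_inverse[of x] reduced_Nil by (auto simp: free_product_def reduced_word_def[of G H x])
  then show "\<exists>y\<in>carrier (free_product G H). y \<otimes>\<^bsub>free_product G H\<^esub> x = \<one>\<^bsub>free_product G H\<^esub>"
    by (auto simp: free_product_def foldr_reduced_Nil)
qed (simp_all add: free_product_def reduced_Nil)

lemma free_product_inl_hom: "free_product_inl G \<in> hom G (free_product G H)"
  by (auto simp: hom_def free_product_def free_product_inl_def reduced_Cons reduced_Nil)

lemma free_product_inr_hom: "free_product_inr H \<in> hom H (free_product G H)"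
  by (auto simp: hom_def free_product_def free_product_inr_def reduced_Cons reduced_Nil)

text \<open>The universal property: homomorphisms out of the two factors extend uniquely.\<close>

lemma free_product_universal:
  fixes K :: "('e, 'f) monoid_scheme"
  assumes K: "group K" and f: "f \<in> hom G K" and g: "g \<in> hom H K"
  shows "\<exists>\<phi> \<in> hom (free_product G H) K.
           (\<forall>x\<in>carrier G. \<phi> (free_product_inl G x) = f x) \<and>
           (\<forall>y\<in>carrier H. \<phi> (free_product_inr H y) = g y)"
proof -
  interpret K: group K by (fact K)
  interpret f: group_hom G K f by unfold_locales (fact f)
  interpret g: group_hom H K g by unfold_locales (fact g)
  define e where "e = case_sum f g"
  define \<phi> where "\<phi> = (\<lambda>w. foldr (\<lambda>x y. e x \<otimes>\<^bsub>K\<^esub> y) w \<one>\<^bsub>K\<^esub>)"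
  have \<phi>_simps [simp]: "\<phi> [] = \<one>\<^bsub>K\<^esub>" "\<phi> (x # w) = e x \<otimes>\<^bsub>K\<^esub> \<phi> w" for x w
    by (simp_all add: \<phi>_def)
  have e_simps [simp]: "e (Inl a) = f a" "e (Inr b) = g b" for a b
    by (simp_all add: e_def)
  have e_closed: "e x \<in> carrier K" if "x \<in> letters" for x
    using that by auto
  have closed: "\<phi> w \<in> carrier K" if "set w \<subseteq> letters" for w
    using that by (induction w) (simp_all add: e_closed)
  have letter: "\<phi> (letter_mult G H x w) = e x \<otimes>\<^bsub>K\<^esub> \<phi> w"
    if x: "x \<in> letters" and w: "set w \<subseteq> letters" for x w
  proof (cases w)
    case Nil
    then show ?thesis by (cases x) auto
  next
    case (Cons y v)
    have c: "\<phi> v \<in> carrier K" using w Cons by (auto intro: closed)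
    show ?thesis
    proof (cases x; cases y)
      fix a b assume ab: "x = Inl a" "y = Inl b"
      then have m: "a \<in> carrier G" "b \<in> carrier G" using x w Cons by auto
      then have "f a \<otimes>\<^bsub>K\<^esub> (f b \<otimes>\<^bsub>K\<^esub> \<phi> v) = f (a \<otimes>\<^bsub>G\<^esub> b) \<otimes>\<^bsub>K\<^esub> \<phi> v"
        using c by (simp add: K.m_assoc)
      then show ?thesis using ab m c Cons by (auto simp del: f.hom_mult)
    next
      fix a b assume ab: "x = Inr a" "y = Inr b"
      then have m: "a \<in> carrier H" "b \<in> carrier H" using x w Cons by auto
      then have "g a \<otimes>\<^bsub>K\<^esub> (g b \<otimes>\<^bsub>K\<^esub> \<phi> v) = g (a \<otimes>\<^bsub>H\<^esub> b) \<otimes>\<^bsub>K\<^esub> \<phi> v"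
        using c by (simp add: K.m_assoc)
      then show ?thesis using ab m c Cons by (auto simp del: g.hom_mult)
    qed (use Cons in auto)
  qed
  have mult: "\<phi> (foldr (letter_mult G H) u w) = \<phi> u \<otimes>\<^bsub>K\<^esub> \<phi> w"
    if "set u \<subseteq> letters" "reduced_word G H w" for u w
    using that(1)
  proof (induction u)
    case Nil
    then show ?case using that(2) closed by (simp add: reduced_word_def)
  next
    case (Cons x u)
    have w: "set w \<subseteq> letters" using that(2) by (simp add: reduced_word_def)
    have "set (foldr (letter_mult G H) u w) \<subseteq> letters"
      using reduced_foldr[of u w] Cons.prems that(2) by (auto simp: reduced_word_def)
    then show ?case
      using Cons e_closed[of x] closed[of u] closed[OF w] by (simp add: letter K.m_assoc)
  qed
  have "\<phi> \<in> hom (free_product G H) K"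
    unfolding hom_def free_product_def
    by (auto simp: reduced_word_def[of G H] closed intro!: mult)
  then show ?thesis
    by (intro bexI[of _ \<phi>]) (auto simp: free_product_inl_def free_product_inr_def)
qed

lemma free_product_universal_unique:
  fixes K :: "('e, 'f) monoid_scheme"
  assumes "\<phi> \<in> hom (free_product G H) K" "\<psi> \<in> hom (free_product G H) K" "group K"
    and "\<And>x. x \<in> carrier G \<Longrightarrow> \<phi> (free_product_inl G x) = \<psi> (free_product_inl G x)"
    and "\<And>y. y \<in> carrier H \<Longrightarrow> \<phi> (free_product_inr H y) = \<psi> (free_product_inr H y)"
    and "w \<in> carrier (free_product G H)"
  shows "\<phi> w = \<psi> w"
proof -
  interpret P: group "free_product G H" by (fact group_free_product)
  have "reduced_word G H w" using assms(6) by (simp add: free_product_def)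
  then show ?thesis
  proof (induction w)
    case Nil
    then show ?case
      using hom_one[OF assms(1) P.is_group assms(3)] hom_one[OF assms(2) P.is_group assms(3)]
      by (simp add: free_product_def)
  next
    case (Cons x w)
    have c: "[x] \<in> carrier (free_product G H)" "w \<in> carrier (free_product G H)"
      using Cons.prems by (auto simp: free_product_def reduced_Cons reduced_Nil)
    have m: "x # w = [x] \<otimes>\<^bsub>free_product G H\<^esub> w"
      using Cons.prems by (cases x; cases w; cases "hd w") (auto simp: free_product_def reduced_Cons)
    have w: "\<phi> w = \<psi> w"
      using Cons.IH Cons.prems by (simp add: reduced_Cons)
    have "\<phi> [x] = \<psi> [x]"
    proof (cases x)
      case (Inl a)
      then show ?thesis
        using Cons.prems assms(4)[of a] by (auto simp: reduced_Cons free_product_inl_def split: if_splits)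
    next
      case (Inr b)
      then show ?thesis
        using Cons.prems assms(5)[of b] by (auto simp: reduced_Cons free_product_inr_def split: if_splits)
    qed
    then show ?case
      using hom_mult[OF assms(1) c] hom_mult[OF assms(2) c] m w by simp
  qed
qed

end

end

theory Submission
  imports Defs "HOL-Library.Function_Algebras" "HOL-Library.Sublist"
begin

text \<open>
  Let \<open>\<Gamma> = G * H\<close> carry a left-ordering \<open>\<prec>\<close>, and let \<open>S\<close> be a finite set of
  positive elements. A second left-ordering that is positive on \<open>S\<close> is found by deforming an
  action of \<open>\<Gamma>\<close> on a linearly ordered set. Because \<open>\<Gamma>\<close> is a free product, conjugating the
  action of \<open>H\<close> by any order automorphism \<open>\<phi>\<close>, while keeping the action of \<open>G\<close>, again
  gives an action of \<open>\<Gamma>\<close>. An action by order automorphisms yields a left-ordering: compare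
  the images of a base point, and break ties with \<open>\<prec>\<close>
  (\<open>automorphism_action_left_ordering\<close>).

  Let \<open>p\<close> be the greatest suffix of a word in \<open>S\<close>, the empty word included. If \<open>\<phi>\<close> fixes
  every point up to that of \<open>p\<close>, then the deformed action moves the base point along the letters
  of a word in \<open>S\<close> exactly as the original one does, so \<open>S\<close> stays positive. Choose \<open>g \<in> G\<close>
  and \<open>h \<in> H\<close> with \<open>p \<prec> g p\<close> and \<open>p \<prec> h p\<close>. The deformed action sends the base point to
  the point of \<open>g p\<close> under the word \<open>g p\<close>, and to the \<open>\<phi>\<close>-image of the point of \<open>h p\<close>
  under \<open>h p\<close>. So it is enough that \<open>\<phi>\<close> carries the point of \<open>h p\<close> to the other side of
  the point of \<open>g p\<close>: this reverses the order of \<open>g p\<close> and \<open>h p\<close>.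

  The ordered set \<open>\<Gamma>\<close> itself can be too rigid to admit such a \<open>\<phi>\<close>. Instead \<open>\<Gamma>\<close> is
  embedded, as the set of point masses, in the additive group of the group ring
  \<open>\<int>[\<Gamma>]\<close>, where \<open>f\<close> is below \<open>f'\<close> if \<open>f' - f\<close> has a positive coefficient at the greatest
  element of its support. Left translation by any \<open>m \<in> \<Gamma>\<close> is additive and preserves this
  order, so an order automorphism is also obtained piecewise, as the map that is the identity up to \<open>p\<close> and \<open>f \<mapsto> p + m (f - p)\<close> above \<open>p\<close>
  (\<open>affine_above_automorphism\<close>). It sends \<open>h p\<close> to \<open>p + m h p - m p\<close>. Since \<open>m\<close> is
  arbitrary, \<open>m h p\<close> can be any element \<open>z\<close> of \<open>\<Gamma>\<close>, and then \<open>m p \<prec> z\<close>. The value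
  \<open>z = p\<close> puts the image below \<open>g p\<close>, and \<open>z = g g p\<close> puts it above;
  the first is used if \<open>g p \<prec> h p\<close>, the second if \<open>h p \<prec> g p\<close>.
\<close>

section \<open>Automorphism groups of ordered sets\<close>

text \<open>Automorphisms are total functions that are the identity outside \<open>X\<close>, so that plain
  composition is the multiplication and no restriction operators are needed. The order condition is
  an equivalence because an implication would make inverses depend on linearity of \<open>lt\<close>.\<close>

definition order_automorphisms :: "'x set \<Rightarrow> ('x \<Rightarrow> 'x \<Rightarrow> bool) \<Rightarrow> ('x \<Rightarrow> 'x) monoid" where
  "order_automorphisms X lt =
     \<lparr>carrier = {f. bij_betw f X X \<and> (\<forall>x. x \<notin> X \<longrightarrow> f x = x) \<and>
                    (\<forall>x\<in>X. \<forall>y\<in>X. lt (f x) (f y) \<longleftrightarrow> lt x y)},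
      monoid.mult = (\<circ>),
      one = id\<rparr>"

lemma order_automorphisms_simps [simp]:
  "f \<otimes>\<^bsub>order_automorphisms X lt\<^esub> g = f \<circ> g"
  "\<one>\<^bsub>order_automorphisms X lt\<^esub> = id"
  by (simp_all add: order_automorphisms_def)

lemma order_automorphismsI:
  assumes "\<And>x. x \<in> X \<Longrightarrow> f x \<in> X" "\<And>x. x \<in> X \<Longrightarrow> g x \<in> X"
    and "\<And>x. x \<in> X \<Longrightarrow> g (f x) = x" "\<And>x. x \<in> X \<Longrightarrow> f (g x) = x"
    and "\<And>x. x \<notin> X \<Longrightarrow> f x = x"
    and "\<And>x y. x \<in> X \<Longrightarrow> y \<in> X \<Longrightarrow> lt (f x) (f y) \<longleftrightarrow> lt x y"
  shows "f \<in> carrier (order_automorphisms X lt)"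
  using assms by (auto simp: order_automorphisms_def intro!: bij_betw_byWitness[where f' = g])

lemma order_automorphisms_in:
  "f \<in> carrier (order_automorphisms X lt) \<Longrightarrow> x \<in> X \<Longrightarrow> f x \<in> X"
  by (auto simp: order_automorphisms_def bij_betw_def)

lemma order_automorphisms_iff:
  "f \<in> carrier (order_automorphisms X lt) \<Longrightarrow> x \<in> X \<Longrightarrow> y \<in> X \<Longrightarrow> lt (f x) (f y) \<longleftrightarrow> lt x y"
  by (simp add: order_automorphisms_def)

lemma group_order_automorphisms: "group (order_automorphisms X lt)"
proof (rule groupI)
  fix f assume f: "f \<in> carrier (order_automorphisms X lt)"
  then have bij: "bij_betw f X X" and out: "\<And>x. x \<notin> X \<Longrightarrow> f x = x"
    and mono: "\<And>x y. x \<in> X \<Longrightarrow> y \<in> X \<Longrightarrow> lt (f x) (f y) \<longleftrightarrow> lt x y"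
    by (auto simp: order_automorphisms_def)
  define g where "g = (\<lambda>x. if x \<in> X then inv_into X f x else x)"
  have gX: "g x \<in> X" "f (g x) = x" if "x \<in> X" for x
    using that bij_betw_inv_into_right[OF bij, of x] bij_betwE[OF bij_betw_inv_into[OF bij]]
    by (simp_all add: g_def)
  have gf: "g (f x) = x" for x
    using bij_betw_inv_into_left[OF bij, of x] bij_betwE[OF bij] out[of x]
    by (cases "x \<in> X") (simp_all add: g_def)
  have fX: "f x \<in> X" if "x \<in> X" for x using that bij by (auto simp: bij_betw_def)
  have "g \<in> carrier (order_automorphisms X lt)"
  proof (rule order_automorphismsI[where g = f])
    fix x y assume "x \<in> X" "y \<in> X"
    then show "lt (g x) (g y) \<longleftrightarrow> lt x y" using mono[of "g x" "g y"] gX by simp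
  next
    show "g x = x" if "x \<notin> X" for x using that by (simp add: g_def)
  qed (simp_all add: gX gf fX)
  moreover have "g \<otimes>\<^bsub>order_automorphisms X lt\<^esub> f = \<one>\<^bsub>order_automorphisms X lt\<^esub>"
    by (auto simp: gf)
  ultimately show "\<exists>g\<in>carrier (order_automorphisms X lt).
      g \<otimes>\<^bsub>order_automorphisms X lt\<^esub> f = \<one>\<^bsub>order_automorphisms X lt\<^esub>" by blast
next
  fix f g assume fg: "f \<in> carrier (order_automorphisms X lt)" "g \<in> carrier (order_automorphisms X lt)"
  then have "bij_betw (f \<circ> g) X X"
    by (auto simp: order_automorphisms_def intro: bij_betw_trans)
  then show "f \<otimes>\<^bsub>order_automorphisms X lt\<^esub> g \<in> carrier (order_automorphisms X lt)"
    using fg bij_betwE[of g X X] by (simp add: order_automorphisms_def)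
qed (simp_all add: order_automorphisms_def comp_assoc)

section \<open>Left-ordered groups\<close>

locale left_ordered_group = group \<Gamma> for \<Gamma> (structure) +
  fixes r
  assumes left_ordering: "left_ordering \<Gamma> r"
begin

definition precedes (infix "\<prec>" 50) where "x \<prec> y \<longleftrightarrow> (x, y) \<in> r - Id"

lemma linear: "linear_order_on (carrier \<Gamma>) r"
  using left_ordering by (simp add: left_ordering_def)

lemma precedes_carrier: "x \<prec> y \<Longrightarrow> x \<in> carrier \<Gamma> \<and> y \<in> carrier \<Gamma>"
  using linear
  by (auto simp: precedes_def linear_order_on_def partial_order_on_def preorder_on_def refl_on_def)

lemma precedes_irrefl [simp]: "\<not> x \<prec> x"
  by (simp add: precedes_def)

lemma precedes_trans [trans]: "x \<prec> y \<Longrightarrow> y \<prec> z \<Longrightarrow> x \<prec> z"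
  using linear
  by (auto simp: precedes_def linear_order_on_def partial_order_on_def preorder_on_def
      dest: transD antisymD)

lemma precedes_linear: "x \<in> carrier \<Gamma> \<Longrightarrow> y \<in> carrier \<Gamma> \<Longrightarrow> x \<prec> y \<or> x = y \<or> y \<prec> x"
  using linear by (auto simp: precedes_def linear_order_on_def total_on_def)

lemma precedes_mult_left:
  "x \<prec> y \<Longrightarrow> z \<in> carrier \<Gamma> \<Longrightarrow> z \<otimes> x \<prec> z \<otimes> y"
  using left_ordering precedes_carrier[of x y] unfolding left_ordering_def precedes_def by blast

lemma finite_has_greatest:
  assumes "finite A" "A \<noteq> {}" "A \<subseteq> carrier \<Gamma>"
  obtains a where "a \<in> A" "\<And>b. b \<in> A \<Longrightarrow> b = a \<or> b \<prec> a"
proof -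
  have "\<exists>a\<in>A. \<forall>b\<in>A. b = a \<or> b \<prec> a"
    using assms
  proof (induction A rule: finite_ne_induct)
    case (insert x A)
    then obtain a where a: "a \<in> A" "\<forall>b\<in>A. b = a \<or> b \<prec> a" by auto
    have "x \<in> carrier \<Gamma>" "a \<in> carrier \<Gamma>" using insert.prems a(1) by auto
    then consider "x = a \<or> x \<prec> a" | "a \<prec> x" using precedes_linear by blast
    then show ?case
    proof cases
      case 1
      then show ?thesis using a by auto
    next
      case 2
      have "b = x \<or> b \<prec> x" if "b \<in> insert x A" for b
        using that a(2) 2 precedes_trans[of b a x] by auto
      then show ?thesis by blast
    qed
  qed simp
  then show thesis using that by blast
qed

section \<open>The leading-coefficient order on integral chains\<close>

text \<open>The additive group of the group ring over the integers.\<close>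

definition finite_chains :: "('a \<Rightarrow> int) set" where
  "finite_chains = {f. finite {x. f x \<noteq> 0} \<and> (\<forall>x. x \<notin> carrier \<Gamma> \<longrightarrow> f x = 0)}"

definition leading_pos :: "('a \<Rightarrow> int) \<Rightarrow> bool" where
  "leading_pos f \<longleftrightarrow> (\<exists>a\<in>carrier \<Gamma>. f a > 0 \<and> (\<forall>b. a \<prec> b \<longrightarrow> f b = 0))"

definition chain_less :: "('a \<Rightarrow> int) \<Rightarrow> ('a \<Rightarrow> int) \<Rightarrow> bool" where
  "chain_less f g \<longleftrightarrow> leading_pos (g - f)"

definition point :: "'a \<Rightarrow> 'a \<Rightarrow> int" where
  "point a = (\<lambda>x. if x = a then 1 else 0)"

definition shift :: "'a \<Rightarrow> ('a \<Rightarrow> int) \<Rightarrow> 'a \<Rightarrow> int" where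
  "shift m f = (\<lambda>x. if x \<in> carrier \<Gamma> then f (inv m \<otimes> x) else 0)"

lemma chains_add: "f \<in> finite_chains \<Longrightarrow> g \<in> finite_chains \<Longrightarrow> f + g \<in> finite_chains"
  unfolding finite_chains_def
  by (auto intro: finite_subset[of _ "{x. f x \<noteq> 0} \<union> {x. g x \<noteq> 0}"])

lemma chains_diff: "f \<in> finite_chains \<Longrightarrow> g \<in> finite_chains \<Longrightarrow> f - g \<in> finite_chains"
  unfolding finite_chains_def
  by (auto intro: finite_subset[of _ "{x. f x \<noteq> 0} \<union> {x. g x \<noteq> 0}"])

lemma point_chains: "a \<in> carrier \<Gamma> \<Longrightarrow> point a \<in> finite_chains"
  by (auto simp: finite_chains_def point_def)

lemma leading_pos_add:
  assumes "leading_pos f" "leading_pos g"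
  shows "leading_pos (f + g)"
proof -
  obtain a where a: "a \<in> carrier \<Gamma>" "f a > 0" "\<And>b. a \<prec> b \<Longrightarrow> f b = 0"
    using assms(1) by (auto simp: leading_pos_def)
  obtain b where b: "b \<in> carrier \<Gamma>" "g b > 0" "\<And>c. b \<prec> c \<Longrightarrow> g c = 0"
    using assms(2) by (auto simp: leading_pos_def)
  from precedes_linear[OF a(1) b(1)] show ?thesis
  proof (elim disjE)
    assume "a \<prec> b"
    then show ?thesis
      unfolding leading_pos_def using a b precedes_trans by (intro bexI[of _ b]) auto
  next
    assume "a = b"
    then show ?thesis
      unfolding leading_pos_def using a b by (intro bexI[of _ b]) auto
  next
    assume "b \<prec> a"
    then show ?thesis
      unfolding leading_pos_def using a b precedes_trans by (intro bexI[of _ a]) auto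
  qed
qed

lemma leading_posI:
  assumes "a \<in> carrier \<Gamma>" "f a > 0" "\<And>b. f b \<noteq> 0 \<Longrightarrow> b = a \<or> b \<prec> a"
  shows "leading_pos f"
proof -
  have "f b = 0" if "a \<prec> b" for b
    using assms(3)[of b] that precedes_trans[of a b a] by auto
  then show ?thesis using assms(1,2) by (auto simp: leading_pos_def)
qed

text \<open>A nonzero chain is positive or negative because its finite support has a greatest element.\<close>

lemma leading_pos_linear:
  assumes "f \<in> finite_chains"
  shows "leading_pos f \<or> f = 0 \<or> leading_pos (- f)"
proof (cases "f = 0")
  case False
  then have "{x. f x \<noteq> 0} \<noteq> {}" by (auto simp: fun_eq_iff)
  moreover have sub: "finite {x. f x \<noteq> 0}" "{x. f x \<noteq> 0} \<subseteq> carrier \<Gamma>"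
    using assms by (auto simp: finite_chains_def)
  ultimately obtain a where a: "f a \<noteq> 0" "\<And>b. f b \<noteq> 0 \<Longrightarrow> b = a \<or> b \<prec> a"
    by (auto elim: finite_has_greatest)
  have ac: "a \<in> carrier \<Gamma>" using sub a(1) by auto
  have top: "f b = 0" if "a \<prec> b" for b
    using a(2)[of b] that precedes_trans precedes_irrefl by blast
  have "f a > 0 \<or> (- f) a > 0" using a(1) by auto
  then show ?thesis
    unfolding leading_pos_def using ac top by fastforce
qed simp

lemma not_leading_pos_0 [simp]: "\<not> leading_pos 0"
  by (simp add: leading_pos_def)

lemma chain_less_irrefl [simp]: "\<not> chain_less f f"
  by (simp add: chain_less_def)

lemma chain_less_trans [trans]: "chain_less f g \<Longrightarrow> chain_less g h \<Longrightarrow> chain_less f h"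
  using leading_pos_add[of "g - f" "h - g"] by (simp add: chain_less_def)

lemma chain_less_linear:
  "f \<in> finite_chains \<Longrightarrow> g \<in> finite_chains \<Longrightarrow> chain_less f g \<or> f = g \<or> chain_less g f"
  using leading_pos_linear[OF chains_diff[of g f]] by (auto simp: chain_less_def)

lemma chain_less_point:
  "a \<in> carrier \<Gamma> \<Longrightarrow> b \<in> carrier \<Gamma> \<Longrightarrow> chain_less (point a) (point b) \<longleftrightarrow> a \<prec> b"
proof -
  have *: "chain_less (point a) (point b)" if "a \<prec> b" for a b
    unfolding chain_less_def leading_pos_def
    using that precedes_carrier[OF that] precedes_trans[of b a b] precedes_trans[of a b a]
    by (intro bexI[of _ b]) (auto simp: point_def)
  assume "a \<in> carrier \<Gamma>" "b \<in> carrier \<Gamma>"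
  then show ?thesis
    using *[of a b] *[of b a] precedes_linear[of a b] chain_less_trans chain_less_irrefl by metis
qed

lemma shift_diff: "shift m (f - g) = shift m f - shift m g"
  by (auto simp: shift_def)

lemma shift_point:
  assumes "m \<in> carrier \<Gamma>" "a \<in> carrier \<Gamma>"
  shows "shift m (point a) = point (m \<otimes> a)"
  using assms by (auto simp: shift_def point_def inv_solve_left')

lemma shift_shift:
  assumes "m \<in> carrier \<Gamma>" "n \<in> carrier \<Gamma>"
  shows "shift m (shift n f) = shift (m \<otimes> n) f"
  using assms by (auto simp: shift_def inv_mult_group m_assoc)

lemma shift_one: "f \<in> finite_chains \<Longrightarrow> shift \<one> f = f"
  by (auto simp: shift_def finite_chains_def fun_eq_iff)

lemma shift_chains:
  assumes "m \<in> carrier \<Gamma>" "f \<in> finite_chains"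
  shows "shift m f \<in> finite_chains"
proof -
  have "{x. shift m f x \<noteq> 0} \<subseteq> (\<otimes>) m ` {x. f x \<noteq> 0}"
  proof
    fix x assume "x \<in> {x. shift m f x \<noteq> 0}"
    then have "x \<in> carrier \<Gamma>" "f (inv m \<otimes> x) \<noteq> 0" by (auto simp: shift_def split: if_splits)
    then show "x \<in> (\<otimes>) m ` {x. f x \<noteq> 0}"
      using assms(1) by (intro image_eqI[of _ _ "inv m \<otimes> x"]) (auto simp: inv_solve_left m_assoc[symmetric])
  qed
  then have "finite {x. shift m f x \<noteq> 0}"
    using assms(2) by (auto simp: finite_chains_def intro: finite_subset)
  then show ?thesis by (auto simp: finite_chains_def shift_def)
qed

text \<open>Left-invariance of the order on the group is what makes left translation carry the leading
  term to the leading term.\<close>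

lemma leading_pos_shift:
  assumes "m \<in> carrier \<Gamma>" "leading_pos f"
  shows "leading_pos (shift m f)"
proof -
  obtain a where a: "a \<in> carrier \<Gamma>" "f a > 0" "\<And>b. a \<prec> b \<Longrightarrow> f b = 0"
    using assms(2) by (auto simp: leading_pos_def)
  show ?thesis
    unfolding leading_pos_def
  proof (intro bexI[of _ "m \<otimes> a"] conjI allI impI)
    have "inv m \<otimes> (m \<otimes> a) = a" using a(1) assms(1) by (simp add: m_assoc[symmetric])
    then show "shift m f (m \<otimes> a) > 0" using a assms(1) by (simp add: shift_def)
    fix b assume b: "m \<otimes> a \<prec> b"
    have "a \<prec> inv m \<otimes> b"
      using precedes_mult_left[OF b, of "inv m"] a(1) assms(1) by (simp add: m_assoc[symmetric])
    then show "shift m f b = 0" by (simp add: shift_def a)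
  qed (use a(1) assms(1) in simp)
qed

lemma leading_pos_shift_iff:
  assumes "m \<in> carrier \<Gamma>" "f \<in> finite_chains"
  shows "leading_pos (shift m f) \<longleftrightarrow> leading_pos f"
  using leading_pos_shift[of m f] leading_pos_shift[of "inv m" "shift m f"] assms
  by (auto simp: shift_shift shift_one)

section \<open>Automorphisms of the chain group\<close>

abbreviation chain_automorphisms where
  "chain_automorphisms \<equiv> order_automorphisms finite_chains chain_less"

definition shift_action :: "'a \<Rightarrow> ('a \<Rightarrow> int) \<Rightarrow> 'a \<Rightarrow> int" where
  "shift_action m f = (if f \<in> finite_chains then shift m f else f)"

lemma shift_action_automorphism:
  assumes "m \<in> carrier \<Gamma>"
  shows "shift_action m \<in> carrier chain_automorphisms"
proof (rule order_automorphismsI[where g = "shift_action (inv m)"])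
  fix f g assume fg: "f \<in> finite_chains" "g \<in> finite_chains"
  show "chain_less (shift_action m f) (shift_action m g) \<longleftrightarrow> chain_less f g"
    using leading_pos_shift_iff[OF assms chains_diff[OF fg(2,1)]] fg
    by (simp add: shift_action_def chain_less_def shift_diff)
qed (use assms in \<open>auto simp: shift_action_def shift_chains shift_shift shift_one\<close>)

lemma shift_action_hom: "shift_action \<in> hom \<Gamma> chain_automorphisms"
  by (auto simp: hom_def shift_action_automorphism)
     (auto simp: shift_action_def shift_shift shift_chains fun_eq_iff)

lemma shift_action_point:
  "m \<in> carrier \<Gamma> \<Longrightarrow> a \<in> carrier \<Gamma> \<Longrightarrow> shift_action m (point a) = point (m \<otimes> a)"
  by (simp add: shift_action_def point_chains shift_point)

text \<open>The deformation. It uses \<^term>\<open>m\<close> only above the point mass at \<^term>\<open>p\<close>; the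
  two pieces fit together because each of them maps its own side of that point onto itself.\<close>

definition affine_above :: "'a \<Rightarrow> 'a \<Rightarrow> ('a \<Rightarrow> int) \<Rightarrow> 'a \<Rightarrow> int" where
  "affine_above p m f =
     (if f \<in> finite_chains \<and> chain_less (point p) f then point p + shift m (f - point p) else f)"

lemma affine_above_gt:
  assumes "p \<in> carrier \<Gamma>" "m \<in> carrier \<Gamma>" "f \<in> finite_chains" "chain_less (point p) f"
  shows "chain_less (point p) (affine_above p m f)"
  using assms leading_pos_shift[of m "f - point p"]
  by (simp add: affine_above_def chain_less_def)

lemma affine_above_chains:
  assumes "p \<in> carrier \<Gamma>" "m \<in> carrier \<Gamma>" "f \<in> finite_chains"
  shows "affine_above p m f \<in> finite_chains"
  using assms by (simp add: affine_above_def chains_add chains_diff point_chains shift_chains)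

lemma affine_above_inverse:
  assumes "p \<in> carrier \<Gamma>" "m \<in> carrier \<Gamma>" "n \<in> carrier \<Gamma>" "n \<otimes> m = \<one>" "f \<in> finite_chains"
  shows "affine_above p n (affine_above p m f) = f"
proof (cases "chain_less (point p) f")
  case True
  have "affine_above p n (affine_above p m f) = point p + shift n (affine_above p m f - point p)"
    using affine_above_gt[OF assms(1,2,5) True] affine_above_chains[OF assms(1,2,5)]
    by (simp add: affine_above_def[of p n])
  also have "affine_above p m f - point p = shift m (f - point p)"
    using True assms(5) by (simp add: affine_above_def)
  also have "shift n (shift m (f - point p)) = f - point p"
    using assms by (simp add: shift_shift shift_one chains_diff point_chains)
  finally show ?thesis by simp
qed (simp add: affine_above_def)

lemma affine_above_automorphism:
  assumes p: "p \<in> carrier \<Gamma>" and m: "m \<in> carrier \<Gamma>"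
  shows "affine_above p m \<in> carrier chain_automorphisms"
proof (rule order_automorphismsI[where g = "affine_above p (inv m)"])
  have mono: "chain_less (affine_above p m f) (affine_above p m g)"
    if fg: "f \<in> finite_chains" "g \<in> finite_chains" "chain_less f g" for f g
  proof (cases "chain_less (point p) f")
    case True
    have "chain_less (point p) g" using True fg(3) by (rule chain_less_trans)
    moreover have "leading_pos (shift m (g - point p) - shift m (f - point p))"
      using leading_pos_shift[OF m, of "g - f"] fg(3)
      by (simp add: shift_diff chain_less_def)
    ultimately show ?thesis
      using True fg(1,2) by (simp add: affine_above_def chain_less_def algebra_simps)
  next
    case False
    show ?thesis
    proof (cases "chain_less (point p) g")
      case True
      have "f = point p \<or> chain_less f (point p)"
        using False chain_less_linear[OF fg(1) point_chains[OF p]] by blast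
      then have "chain_less f (affine_above p m g)"
        using affine_above_gt[OF p m fg(2) True] chain_less_trans by blast
      then show ?thesis using False by (simp add: affine_above_def[of p m f])
    qed (use False fg in \<open>simp add: affine_above_def\<close>)
  qed
  fix f g assume fg: "f \<in> finite_chains" "g \<in> finite_chains"
  show "chain_less (affine_above p m f) (affine_above p m g) \<longleftrightarrow> chain_less f g"
    using mono[OF fg] mono[OF fg(2,1)] chain_less_linear[OF fg] chain_less_trans chain_less_irrefl
    by metis
next
  show "affine_above p m f = f" if "f \<notin> finite_chains" for f
    using that by (simp add: affine_above_def)
qed (use p m in \<open>simp_all add: affine_above_chains affine_above_inverse\<close>)

lemma affine_above_point_fixed:
  assumes "a = p \<or> a \<prec> p" "p \<in> carrier \<Gamma>"
  shows "affine_above p m (point a) = point a"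
proof -
  have "a \<in> carrier \<Gamma>" using assms precedes_carrier by blast
  then have "\<not> chain_less (point p) (point a)"
    using assms precedes_trans[of p a p] by (auto simp: chain_less_point)
  then show ?thesis by (simp add: affine_above_def)
qed

lemma affine_above_point:
  assumes "p \<prec> a" "m \<in> carrier \<Gamma>"
  shows "affine_above p m (point a) = point p + (point (m \<otimes> a) - point (m \<otimes> p))"
  using assms precedes_carrier[OF assms(1)]
  by (simp add: affine_above_def chain_less_point point_chains shift_diff shift_point)

section \<open>Left-orderings from actions\<close>

text \<open>The base point may have a nontrivial stabilizer. Breaking ties with the given ordering
  orders the cosets of the stabilizer by the orbit, and each coset by \<^term>\<open>r\<close>.\<close>

lemma automorphism_action_left_ordering:
  assumes hom: "\<alpha> \<in> hom \<Gamma> chain_automorphisms" and v: "v \<in> finite_chains"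
  shows "left_ordering \<Gamma> {(x, y). x \<in> carrier \<Gamma> \<and> y \<in> carrier \<Gamma> \<and>
           (chain_less (\<alpha> x v) (\<alpha> y v) \<or> \<alpha> x v = \<alpha> y v \<and> (x, y) \<in> r)}"
    (is "left_ordering \<Gamma> ?s")
proof -
  have aut: "\<alpha> x \<in> carrier chain_automorphisms" if "x \<in> carrier \<Gamma>" for x
    using hom that by (auto simp: hom_def)
  have orbit: "\<alpha> x v \<in> finite_chains" if "x \<in> carrier \<Gamma>" for x
    using order_automorphisms_in[OF aut[OF that] v] .
  have mult: "\<alpha> (z \<otimes> x) v = \<alpha> z (\<alpha> x v)" if "z \<in> carrier \<Gamma>" "x \<in> carrier \<Gamma>" for z x
    using hom_mult[OF hom that] by simp
  have lin: "refl_on (carrier \<Gamma>) r" "trans r" "antisym r" "total_on (carrier \<Gamma>) r"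
    using linear by (auto simp: linear_order_on_def partial_order_on_def preorder_on_def)
  have asym: "\<not> (chain_less f g \<and> chain_less g f)" for f g
    using chain_less_trans chain_less_irrefl by blast
  have "refl_on (carrier \<Gamma>) ?s" using lin(1) by (auto simp: refl_on_def)
  moreover have "trans ?s"
  proof (rule transI)
    fix x y z assume "(x, y) \<in> ?s" "(y, z) \<in> ?s"
    then show "(x, z) \<in> ?s"
      using chain_less_trans[of "\<alpha> x v" "\<alpha> y v" "\<alpha> z v"] transD[OF lin(2), of x y z] by auto
  qed
  moreover have "antisym ?s"
    using asym antisymD[OF lin(3)] by (auto simp: antisym_def)
  moreover have "total_on (carrier \<Gamma>) ?s"
    using chain_less_linear[OF orbit orbit] lin(4) by (fastforce simp: total_on_def)
  moreover have "(z \<otimes> x, z \<otimes> y) \<in> ?s - Id"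
    if xyz: "x \<in> carrier \<Gamma>" "y \<in> carrier \<Gamma>" "z \<in> carrier \<Gamma>" and xy: "(x, y) \<in> ?s - Id" for x y z
  proof -
    have "chain_less (\<alpha> (z \<otimes> x) v) (\<alpha> (z \<otimes> y) v) \<longleftrightarrow> chain_less (\<alpha> x v) (\<alpha> y v)"
      using xyz order_automorphisms_iff[OF aut[OF xyz(3)] orbit[OF xyz(1)] orbit[OF xyz(2)]]
      by (simp add: mult)
    moreover have "z \<otimes> x \<noteq> z \<otimes> y" using xy xyz by simp
    moreover have "(z \<otimes> x, z \<otimes> y) \<in> r" if "(x, y) \<in> r"
      using precedes_mult_left[of x y z] that xy xyz(3) by (auto simp: precedes_def)
    ultimately show ?thesis using xy xyz by (auto simp: mult)
  qed
  ultimately show ?thesis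
    by (auto simp: left_ordering_def linear_order_on_def partial_order_on_def preorder_on_def)
qed

end

section \<open>Deforming a left-ordering of a free product\<close>

lemma reduced_word_append_right: "reduced_word G H (u @ v) \<Longrightarrow> reduced_word G H v"
  by (simp add: reduced_word_def successively_append_iff)

lemma free_product_Cons:
  assumes w: "x # w \<in> carrier (free_product G H)"
  shows "w \<in> carrier (free_product G H)" "[x] \<in> carrier (free_product G H)"
    and "x # w = [x] \<otimes>\<^bsub>free_product G H\<^esub> w"
proof -
  have red: "reduced_word G H (x # w)" using w by (simp add: free_product_def)
  show "w \<in> carrier (free_product G H)" "[x] \<in> carrier (free_product G H)"
    using red by (auto simp: free_product_def reduced_word_def successively_Cons)
  show "x # w = [x] \<otimes>\<^bsub>free_product G H\<^esub> w"
    using red by (cases x; cases w; cases "hd w") (auto simp: free_product_def reduced_word_def)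
qed

text \<open>Left multiplication by a nontrivial element has no fixed point, so it or its inverse moves
  \<^term>\<open>p\<close> upwards.\<close>

lemma (in left_ordered_group) hom_moves_up:
  assumes K: "group K" and i: "i \<in> hom K \<Gamma>" and k: "k \<in> carrier K" "i k \<noteq> \<one>"
    and p: "p \<in> carrier \<Gamma>"
  obtains l where "l \<in> carrier K" "p \<prec> i l \<otimes> p"
proof -
  interpret i: group_hom K \<Gamma> i
    using K i by (simp add: group_hom_def group_hom_axioms_def)
  have ik: "i k \<in> carrier \<Gamma>" using k(1) by simp
  have "i k \<otimes> p \<noteq> p" using ik p k(2) by (metis r_cancel_one)
  then consider "p \<prec> i k \<otimes> p" | "i k \<otimes> p \<prec> p"
    using precedes_linear[of "i k \<otimes> p" p] ik p by auto
  then show thesis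
  proof cases
    case 1
    then show ?thesis using that k(1) by blast
  next
    case 2
    have "inv (i k) \<otimes> (i k \<otimes> p) = p" using ik p by (simp add: m_assoc[symmetric])
    then have "p \<prec> i (inv\<^bsub>K\<^esub> k) \<otimes> p"
      using precedes_mult_left[OF 2, of "inv (i k)"] ik k(1) by (simp add: i.hom_inv)
    then show ?thesis using that[of "inv\<^bsub>K\<^esub> k"] k(1) i.G.inv_closed by blast
  qed
qed

theorem theoremA:
  fixes G :: "('a, 'c) monoid_scheme" and H :: "('b, 'd) monoid_scheme"
  assumes "group G" and "group H"
    and "\<not> trivial_group G" and "\<not> trivial_group H"
    and "left_orderable G" and "left_orderable H"
  shows "\<not> (\<exists>r. isolated_left_ordering (free_product G H) r)"
proof
  assume "\<exists>r. isolated_left_ordering (free_product G H) r"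
  then obtain r where iso: "isolated_left_ordering (free_product G H) r" by blast
  define \<Gamma> where "\<Gamma> = free_product G H"
  have r: "left_ordering \<Gamma> r"
    using iso by (simp add: isolated_left_ordering_def \<Gamma>_def)
  obtain S where S: "finite S" "S \<subseteq> carrier \<Gamma>" "\<forall>x\<in>S. (\<one>\<^bsub>\<Gamma>\<^esub>, x) \<in> r - Id"
    and unique: "\<forall>s. left_ordering \<Gamma> s \<and> (\<forall>x\<in>S. (\<one>\<^bsub>\<Gamma>\<^esub>, x) \<in> s - Id) \<longrightarrow> s = r"
    using iso unfolding isolated_left_ordering_def \<Gamma>_def[symmetric] by blast
  interpret G: group G by fact
  interpret H: group H by fact
  interpret group \<Gamma> unfolding \<Gamma>_def by (rule group_free_product) fact+
  interpret left_ordered_group \<Gamma> r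
    by unfold_locales (rule r)
  write precedes (infix "\<prec>" 50)
  let ?i = "free_product_inl G :: 'a \<Rightarrow> ('a + 'b) list"
  let ?j = "free_product_inr H :: 'b \<Rightarrow> ('a + 'b) list"
  have i: "?i \<in> hom G \<Gamma>" and j: "?j \<in> hom H \<Gamma>"
    unfolding \<Gamma>_def
    using free_product_inl_hom[OF assms(1,2)] free_product_inr_hom[OF assms(1,2)] .
  have one: "\<one>\<^bsub>\<Gamma>\<^esub> = []" by (simp add: \<Gamma>_def free_product_def)

  \<comment> \<open>The suffixes of a word are the positions through which its letters, applied one by one from
    the right, move the identity.\<close>
  define T where "T = insert [] (\<Union>s\<in>S. set (suffixes s))"
  have T_carrier: "T \<subseteq> carrier \<Gamma>"
    using S(2) one one_closed reduced_word_append_right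
    by (fastforce simp: T_def suffix_def \<Gamma>_def free_product_def)
  have T_tail: "w \<in> T" if "x # w \<in> T" for x w
    using that by (auto simp: T_def intro: suffix_ConsD)
  have "finite T" using S(1) by (simp add: T_def)
  then obtain p where p: "p \<in> T" "\<And>w. w \<in> T \<Longrightarrow> w = p \<or> w \<prec> p"
    using T_carrier finite_has_greatest[of T] by (auto simp: T_def)
  have pc: "p \<in> carrier \<Gamma>" using p(1) T_carrier by auto

  obtain g0 where "g0 \<in> carrier G" "g0 \<noteq> \<one>\<^bsub>G\<^esub>"
    using assms(3) by (auto simp: trivial_group_def)
  then obtain g where g: "g \<in> carrier G" "p \<prec> ?i g \<otimes>\<^bsub>\<Gamma>\<^esub> p"
    using hom_moves_up[OF assms(1) i _ _ pc, of g0] by (auto simp: one free_product_inl_def)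
  obtain h0 where "h0 \<in> carrier H" "h0 \<noteq> \<one>\<^bsub>H\<^esub>"
    using assms(4) by (auto simp: trivial_group_def)
  then obtain h where h: "h \<in> carrier H" "p \<prec> ?j h \<otimes>\<^bsub>\<Gamma>\<^esub> p"
    using hom_moves_up[OF assms(2) j _ _ pc, of h0] by (auto simp: one free_product_inr_def)
  define gp where "gp = ?i g \<otimes>\<^bsub>\<Gamma>\<^esub> p"
  define hp where "hp = ?j h \<otimes>\<^bsub>\<Gamma>\<^esub> p"
  have ig: "?i g \<in> carrier \<Gamma>" and jh: "?j h \<in> carrier \<Gamma>"
    using i j g(1) h(1) by (auto simp: hom_def)
  have gpc: "gp \<in> carrier \<Gamma>" and hpc: "hp \<in> carrier \<Gamma>"
    and p_gp: "p \<prec> gp" and p_hp: "p \<prec> hp"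
    using ig jh pc g h by (simp_all add: gp_def hp_def)
  have "gp \<noteq> hp"
  proof
    assume "gp = hp"
    then have "?i g = ?j h" using ig jh pc by (simp add: gp_def hp_def)
    then have "?i g = \<one>\<^bsub>\<Gamma>\<^esub>"
      by (auto simp: one free_product_inl_def free_product_inr_def split: if_splits)
    then show False using p_gp pc by (simp add: gp_def)
  qed

  \<comment> \<open>The target \<open>z\<close> of \<open>hp\<close> under \<open>m\<close>: low enough, or high enough, to move the image of
    \<open>hp\<close> past \<open>gp\<close>.\<close>
  define z where "z = (if gp \<prec> hp then p else ?i g \<otimes>\<^bsub>\<Gamma>\<^esub> gp)"
  have zc: "z \<in> carrier \<Gamma>" using ig gpc pc by (simp add: z_def)
  define m where "m = z \<otimes>\<^bsub>\<Gamma>\<^esub> inv\<^bsub>\<Gamma>\<^esub> hp"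
  have mc: "m \<in> carrier \<Gamma>" using zc hpc by (simp add: m_def)
  have m_hp: "m \<otimes>\<^bsub>\<Gamma>\<^esub> hp = z" using zc hpc by (simp add: m_def m_assoc)
  define q where "q = m \<otimes>\<^bsub>\<Gamma>\<^esub> p"
  have q_z: "q \<prec> z" using precedes_mult_left[OF p_hp mc] by (simp add: q_def m_hp)
  define \<phi> where "\<phi> = affine_above p m"
  have \<phi>: "\<phi> \<in> carrier chain_automorphisms"
    unfolding \<phi>_def using pc mc by (rule affine_above_automorphism)
  have \<phi>_hp: "\<phi> (point hp) = point p + (point z - point q)"
    using affine_above_point[OF p_hp mc] by (simp add: \<phi>_def m_hp q_def)
  have flip_less: "chain_less (\<phi> (point hp)) (point gp)" if "gp \<prec> hp"
  proof -
    have q_p: "q \<prec> p" and z: "z = p" using q_z that by (simp_all add: z_def)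
    have "q \<prec> gp" using q_p p_gp by (rule precedes_trans)
    then show ?thesis
      unfolding chain_less_def \<phi>_hp z using gpc p_gp
      by (intro leading_posI[of gp]) (auto simp: point_def split: if_splits)
  qed
  have flip_greater: "chain_less (point gp) (\<phi> (point hp))" if "\<not> gp \<prec> hp"
  proof -
    have gp_z: "gp \<prec> z"
      using that precedes_mult_left[OF p_gp ig] by (simp add: z_def gp_def)
    then have "p \<prec> z" using p_gp precedes_trans by blast
    then show ?thesis
      unfolding chain_less_def \<phi>_hp using zc gp_z q_z
      by (intro leading_posI[of z]) (auto simp: point_def split: if_splits)
  qed

  \<comment> \<open>The deformed action: translations on \<open>G\<close>, translations conjugated by \<open>\<phi>\<close> on \<open>H\<close>.\<close>
  interpret A: group chain_automorphisms by (rule group_order_automorphisms)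
  define \<psi> where "\<psi> = inv\<^bsub>chain_automorphisms\<^esub> \<phi>"
  have \<psi>: "\<psi> \<in> carrier chain_automorphisms" using \<phi> by (simp add: \<psi>_def)
  have \<psi>\<phi>: "\<psi> (\<phi> f) = f" for f
    using A.l_inv[OF \<phi>] by (simp add: \<psi>_def fun_eq_iff)
  define actG where "actG = shift_action \<circ> ?i"
  define actH where "actH = (\<lambda>y. \<phi> \<circ> shift_action (?j y) \<circ> \<psi>)"
  have actG: "actG \<in> hom G chain_automorphisms"
    unfolding actG_def by (rule Group.hom_compose[OF i shift_action_hom])
  have actH: "actH \<in> hom H chain_automorphisms"
  proof (rule homI)
    fix x y assume xy: "x \<in> carrier H" "y \<in> carrier H"
    have c: "?j x \<in> carrier \<Gamma>" "?j y \<in> carrier \<Gamma>" using j xy by (auto simp: hom_def)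
    have "shift_action (?j (x \<otimes>\<^bsub>H\<^esub> y)) = shift_action (?j x) \<circ> shift_action (?j y)"
      using hom_mult[OF j xy] hom_mult[OF shift_action_hom c] by simp
    then show "actH (x \<otimes>\<^bsub>H\<^esub> y) = actH x \<otimes>\<^bsub>chain_automorphisms\<^esub> actH y"
      by (simp add: actH_def comp_def \<psi>\<phi>)
  next
    fix x assume "x \<in> carrier H"
    then have "shift_action (?j x) \<in> carrier chain_automorphisms"
      using j by (intro shift_action_automorphism) (auto simp: hom_def)
    then show "actH x \<in> carrier chain_automorphisms"
      using A.m_closed[OF A.m_closed[OF \<phi>] \<psi>] by (simp add: actH_def)
  qed
  obtain \<alpha> where \<alpha>: "\<alpha> \<in> hom \<Gamma> chain_automorphisms"
    and \<alpha>_i: "\<And>x. x \<in> carrier G \<Longrightarrow> \<alpha> (?i x) = actG x"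
    and \<alpha>_j: "\<And>y. y \<in> carrier H \<Longrightarrow> \<alpha> (?j y) = actH y"
    using free_product_universal[OF assms(1,2) A.is_group actG actH] unfolding \<Gamma>_def by auto
  have \<alpha>_mult: "\<alpha> (x \<otimes>\<^bsub>\<Gamma>\<^esub> y) f = \<alpha> x (\<alpha> y f)" if "x \<in> carrier \<Gamma>" "y \<in> carrier \<Gamma>" for x y f
    using hom_mult[OF \<alpha> that] by simp
  have \<phi>_T: "\<phi> (point w) = point w" if "w \<in> T" for w
    unfolding \<phi>_def using p(2)[OF that] pc by (rule affine_above_point_fixed)
  have \<psi>_T: "\<psi> (point w) = point w" if "w \<in> T" for w
    using \<psi>\<phi>[of "point w"] \<phi>_T[OF that] by simp

  \<comment> \<open>On the suffixes the deformation is invisible, since \<open>\<phi>\<close> fixes every position up to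
    \<open>p\<close>. The base point is the point mass at the identity, the empty word.\<close>
  have \<alpha>_T: "\<alpha> w (point []) = point w" if "w \<in> T" for w
    using that
  proof (induction w)
    case Nil
    have "\<alpha> \<one>\<^bsub>\<Gamma>\<^esub> = id" using hom_one[OF \<alpha> is_group A.is_group] by simp
    then show ?case by (simp add: one)
  next
    case (Cons x w)
    have wT: "w \<in> T" using Cons.prems by (rule T_tail)
    have xw: "x # w \<in> carrier (free_product G H)"
      using Cons.prems T_carrier by (auto simp: \<Gamma>_def)
    note c = free_product_Cons[OF xw, folded \<Gamma>_def]
    have IH: "\<alpha> w (point []) = point w" using Cons.IH wT by blast
    show ?case
    proof (cases x)
      case (Inl a)
      have a: "a \<in> carrier G" "[x] = ?i a"
        using c(2) Inl by (auto simp: \<Gamma>_def free_product_def reduced_Cons assms(1,2) free_product_inl_def)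
      then show ?thesis
        using \<alpha>_mult[OF c(2,1)] \<alpha>_i[OF a(1)] IH c shift_action_point[OF c(2,1)]
        by (simp add: actG_def)
    next
      case (Inr a)
      have a: "a \<in> carrier H" "[x] = ?j a"
        using c(2) Inr by (auto simp: \<Gamma>_def free_product_def reduced_Cons assms(1,2) free_product_inr_def)
      then show ?thesis
        using \<alpha>_mult[OF c(2,1)] \<alpha>_j[OF a(1)] IH c shift_action_point[OF c(2,1)]
          \<phi>_T[OF Cons.prems] \<psi>_T[OF wT]
        by (simp add: actH_def)
    qed
  qed

  define s where "s = {(x, y). x \<in> carrier \<Gamma> \<and> y \<in> carrier \<Gamma> \<and>
    (chain_less (\<alpha> x (point [])) (\<alpha> y (point [])) \<or>
     \<alpha> x (point []) = \<alpha> y (point []) \<and> (x, y) \<in> r)}"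
  have "left_ordering \<Gamma> s"
    unfolding s_def using \<alpha> point_chains[OF one_closed] unfolding one
    by (rule automorphism_action_left_ordering)
  moreover have "\<forall>x\<in>S. (\<one>\<^bsub>\<Gamma>\<^esub>, x) \<in> s - Id"
  proof
    fix x assume x: "x \<in> S"
    have "x \<in> T" "[] \<in> T" using x by (auto simp: T_def)
    moreover have "[] \<prec> x" using S(3) x by (auto simp: precedes_def one)
    moreover from this have "[] \<noteq> x" by auto
    ultimately show "(\<one>\<^bsub>\<Gamma>\<^esub>, x) \<in> s - Id"
      using precedes_carrier[of "[]" x] by (simp add: s_def one \<alpha>_T chain_less_point)
  qed
  ultimately have "s = r" using unique by blast
  have \<alpha>_gp: "\<alpha> gp (point []) = point gp"
    using \<alpha>_mult[OF ig pc] \<alpha>_T[OF p(1)] \<alpha>_i[OF g(1)] shift_action_point[OF ig pc]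
    by (simp add: gp_def actG_def)
  have \<alpha>_hp: "\<alpha> hp (point []) = \<phi> (point hp)"
    using \<alpha>_mult[OF jh pc] \<alpha>_T[OF p(1)] \<alpha>_j[OF h(1)] shift_action_point[OF jh pc] \<psi>_T[OF p(1)]
    by (simp add: hp_def actH_def)
  show False
  proof (cases "gp \<prec> hp")
    case True
    then have "(hp, gp) \<in> s"
      using flip_less gpc hpc by (simp add: s_def \<alpha>_gp \<alpha>_hp)
    then have "hp \<prec> gp" using \<open>s = r\<close> \<open>gp \<noteq> hp\<close> by (simp add: precedes_def)
    then show ?thesis using True precedes_trans precedes_irrefl by blast
  next
    case False
    then have "hp \<prec> gp" using precedes_linear[OF gpc hpc] \<open>gp \<noteq> hp\<close> by auto
    then have "(gp, hp) \<in> s"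
      using flip_greater[OF False] gpc hpc by (simp add: s_def \<alpha>_gp \<alpha>_hp)
    then show ?thesis using False \<open>s = r\<close> \<open>gp \<noteq> hp\<close> by (simp add: precedes_def)
  qed
qed

end
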